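(* Let $n,m\in\mathbb{N}$ and let $F:(\mathbb{R}_+)^m\to\mathbb{R}$ be a Borel measurable function which vanishes on hyperplanes, that is, $F(y_1,\ldots,y_m)=0$ if $y_k=0$ for some $k\in\{1,\ldots,m\}$. If $$\int_{\mathbb{R}^n}F(u_1(x),\ldots,u_m(x))\,dx\le\int_{\mathbb{R}^n}F(u_1^*(x),\ldots,u_m^*(x))\,dx$$ for any $(u_1,\ldots,u_m)\in\mathcal{F}^m$, then $F$ is supermodular, that is, $$F(y+he_i+ke_j)+F(y)\ge F(y+he_i)+F(y+ke_j)$$ for every $y\in(\mathbb{R}_+)^m$, all $i,j\in\{1,\ldots,m\}$ with $i\ne j$, and all $h,k>0$.
   Context: $\mathbb{R}_+=[0,\infty)$; $e_i$ is the $i$-th standard basis vector of $\mathbb{R}^m$; $\mu$ (also written $dx$) is Lebesgue measure on $\mathbb{R}^n$. $\mathcal{F}$ denotes the set of nonnegative measurable functions $u$ on $\mathbb{R}^n$ that vanish at infinity, i.e. $\mu\{u>t\}<\infty$ for every $t>0$. For $u\in\mathcal{F}$, $u^*$ is its Schwarz symmetrization (symmetric decreasing rearrangement): the unique lower semicontinuous function on $\mathbb{R}^n$ which is radially symmetric, radially nonincreasing and such that $\mu\{a<u\le b\}=\mu\{a<u^*\le b\}$ for all numbers $\inf u<a<b$. *)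

theory Defs
  imports "HOL-Analysis.Analysis"
begin

definition nonneg_orthant :: "(real ^ 'm) set" where
  "nonneg_orthant = {y. \<forall>i. 0 \<le> y $ i}"

text \<open>Functions on the orthant are total functions on the whole space whose values outside
  \<^const>\<open>nonneg_orthant\<close> are never used.\<close>

definition vanishes_on_hyperplanes :: "(real ^ 'm \<Rightarrow> real) \<Rightarrow> bool" where
  "vanishes_on_hyperplanes F \<longleftrightarrow> (\<forall>y\<in>nonneg_orthant. (\<exists>k. y $ k = 0) \<longrightarrow> F y = 0)"

definition supermodular :: "(real ^ 'm \<Rightarrow> real) \<Rightarrow> bool" where
  "supermodular F \<longleftrightarrow>
     (\<forall>y\<in>nonneg_orthant. \<forall>i j. \<forall>h>0. \<forall>k>0. i \<noteq> j \<longrightarrow>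
        F (y + h *\<^sub>R axis i 1 + k *\<^sub>R axis j 1) + F y
          \<ge> F (y + h *\<^sub>R axis i 1) + F (y + k *\<^sub>R axis j 1))"

definition vanishing_functions :: "(real ^ 'n \<Rightarrow> real) set" where
  "vanishing_functions =
     {u. u \<in> borel_measurable lebesgue \<and> (\<forall>x. 0 \<le> u x) \<and>
         (\<forall>t>0. emeasure lebesgue {x. t < u x} < \<infinity>)}"

text \<open>The rearrangement of an essentially unbounded function takes the value \<open>\<infinity>\<close> at the origin, by lower
  semicontinuity, so rearrangements are \<^typ>\<open>ennreal\<close>-valued; composing with \<^const>\<open>enn2real\<close>
  affects only the null set \<open>{0}\<close>. The upper level \<open>b\<close> may be \<open>\<infinity>\<close>;
  otherwise the values of \<open>v\<close> could be changed to \<open>\<infinity>\<close> on a ball without violating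
  equimeasurability.\<close>

definition is_schwarz_symmetrization :: "(real ^ 'n \<Rightarrow> real) \<Rightarrow> (real ^ 'n \<Rightarrow> ennreal) \<Rightarrow> bool" where
  "is_schwarz_symmetrization u v \<longleftrightarrow>
     (\<forall>t. open {x. t < v x}) \<and>
     (\<forall>x y. norm x = norm y \<longrightarrow> v x = v y) \<and>
     (\<forall>x y. norm x \<le> norm y \<longrightarrow> v y \<le> v x) \<and>
     (\<forall>a b. (INF x. ennreal (u x)) < a \<and> a < b \<longrightarrow>
        emeasure lebesgue {x. a < ennreal (u x) \<and> ennreal (u x) \<le> b} =
        emeasure lebesgue {x. a < v x \<and> v x \<le> b})"

definition schwarz_symmetrization :: "(real ^ 'n \<Rightarrow> real) \<Rightarrow> real ^ 'n \<Rightarrow> ennreal" where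
  "schwarz_symmetrization u = (THE v. is_schwarz_symmetrization u v)"

text \<open>The Lebesgue integral with values in \<open>[-\<infinity>, \<infinity>]\<close>; it is meaningful if the positive and the
  negative part do not both have infinite integral.\<close>

definition has_ext_integral :: "(real ^ 'n \<Rightarrow> real) \<Rightarrow> bool" where
  "has_ext_integral g \<longleftrightarrow> g \<in> borel_measurable lebesgue \<and>
     ((\<integral>\<^sup>+ x. ennreal (g x) \<partial>lebesgue) < \<infinity> \<or> (\<integral>\<^sup>+ x. ennreal (- g x) \<partial>lebesgue) < \<infinity>)"

definition ext_integral :: "(real ^ 'n \<Rightarrow> real) \<Rightarrow> ereal" where
  "ext_integral g =
     enn2ereal (\<integral>\<^sup>+ x. ennreal (g x) \<partial>lebesgue) - enn2ereal (\<integral>\<^sup>+ x. ennreal (- g x) \<partial>lebesgue)"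

text \<open>The definite description is justified by \<open>schwarz_ex1\<close> below.\<close>

definition ball_vol :: "real ^ 'n \<Rightarrow> ennreal" where
  "ball_vol x = ennreal (unit_ball_vol (real DIM(real ^ 'n)) * norm x ^ DIM(real ^ 'n))"

lemma emeasure_ball_vol:
  fixes x :: "real ^ 'n"
  shows "emeasure lebesgue (ball (0 :: real ^ 'n) (norm x)) = ball_vol x"
    and "emeasure lebesgue (cball (0 :: real ^ 'n) (norm x)) = ball_vol x"
  by (simp_all add: ball_vol_def emeasure_ball emeasure_cball)

lemma emeasure_ball_vol_less:
  fixes D :: ennreal
  assumes "D < \<infinity>"
  shows "emeasure lebesgue {x :: real ^ 'n. ball_vol x < D} = D"
proof -
  let ?n = "DIM(real ^ 'n)" and ?w = "unit_ball_vol (real DIM(real ^ 'n))"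
  obtain d where d: "D = ennreal d" "d \<ge> 0"
    using assms by (cases D) auto
  have w: "?w > 0" by simp
  have n: "?n > 0" by (rule DIM_positive)
  define r where "r = root ?n (d / ?w)"
  have r0: "r \<ge> 0" using d w by (auto simp: r_def)
  have rn: "r ^ ?n = d / ?w" 
    unfolding r_def by (rule real_root_pow_pos2[OF n]) (use d w in auto)
  have "ball_vol x < D \<longleftrightarrow> norm x < r" for x :: "real ^ 'n"
  proof -
    have "ball_vol x < D \<longleftrightarrow> ?w * norm x ^ ?n < d"
      unfolding ball_vol_def d by (rule ennreal_less_iff) (use w in auto)
    also have "\<dots> \<longleftrightarrow> norm x ^ ?n < r ^ ?n"
      unfolding rn using pos_less_divide_eq[OF w, of "norm x ^ ?n" d] by (simp only: mult.commute)
    also have "\<dots> \<longleftrightarrow> norm x < r"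
      using r0 n by (meson norm_ge_zero not_le power_mono power_strict_mono)
    finally show ?thesis .
  qed
  then have "{x :: real ^ 'n. ball_vol x < D} = ball 0 r"
    by (intro set_eqI) (simp only: mem_Collect_eq mem_ball_0)
  moreover have "emeasure lebesgue (ball (0 :: real ^ 'n) r) = ennreal (?w * r ^ ?n)"
    using r0 by (simp add: emeasure_ball)
  moreover have "?w * r ^ ?n = d"
    unfolding rn using w by (metis less_irrefl nonzero_eq_divide_eq mult.commute)
  ultimately show ?thesis
    by (simp only: d)
qed

lemma schwarz_existence:
  fixes u :: "real ^ 'n \<Rightarrow> real"
  assumes u: "u \<in> vanishing_functions"
  shows "\<exists>v. is_schwarz_symmetrization u v"
proof -
  define U where "U x = ennreal (u x)" for x
  define d where "d t = emeasure lebesgue {x. t < U x}" for t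
  define v where "v x = Sup {t. ball_vol x < d t}" for x :: "real ^ 'n"
  have um[measurable]: "u \<in> borel_measurable lebesgue"
    and fin: "\<And>t. t > 0 \<Longrightarrow> emeasure lebesgue {x. t < u x} < \<infinity>"
    using u by (auto simp: vanishing_functions_def)
  have Um[measurable]: "U \<in> borel_measurable lebesgue"
    unfolding U_def by measurable
  have meas: "{x. t < U x} \<in> sets lebesgue" for t
    using borel_measurable_less[of "\<lambda>_. t" lebesgue U] by simp
  have mono: "s \<le> t \<Longrightarrow> d t \<le> d s" for s t
    unfolding d_def by (intro emeasure_mono meas) auto
  have dfin: "d t < \<infinity>" if "t > 0" for t
  proof (cases t)
    case (real r)
    then have "{x. t < U x} = {x. r < u x}"
      by (auto simp: U_def ennreal_less_iff)
    then show ?thesis using real that fin[of r] by (simp add: d_def)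
  qed (simp add: d_def)
  have key: "t < v x \<longleftrightarrow> ball_vol x < d t" for t x
  proof
    assume "t < v x"
    then obtain s where "t < s" "ball_vol x < d s" by (auto simp: v_def less_Sup_iff)
    then show "ball_vol x < d t" using mono[OF less_imp_le[of t s]] by (blast intro: less_le_trans)
  next
    assume *: "ball_vol x < d t"
    have "t \<noteq> top"
    proof
      assume "t = top"
      then have "d t = 0" by (simp add: d_def)
      with * show False by simp
    qed
    then obtain r where r: "t = ennreal r" "r \<ge> 0" by (cases t) auto
    let ?f = "\<lambda>k::nat. ennreal (r + 1 / real (Suc k))"
    have Un: "{x. t < U x} = (\<Union>k. {x. ?f k < U x})"
    proof (intro equalityI subsetI)
      fix x assume "x \<in> {x. t < U x}"
      then have "r < u x" using r by (simp add: U_def ennreal_less_iff)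
      then obtain k where "1 / real (Suc k) < u x - r"
        using reals_Archimedean[of "u x - r"] by (auto simp: inverse_eq_divide)
      then have "?f k < U x" using r by (simp add: U_def ennreal_less_iff del: of_nat_Suc ennreal_plus)
      then show "x \<in> (\<Union>k. {x. ?f k < U x})" by blast
    next
      fix x assume "x \<in> (\<Union>k. {x. ?f k < U x})"
      then obtain k where "?f k < U x" by blast
      moreover have "t \<le> ?f k" using r by (intro order.trans[OF eq_refl[OF r(1)] ennreal_leI]) simp
      ultimately show "x \<in> {x. t < U x}" by (simp add: order.strict_trans1)
    qed
    have "incseq (\<lambda>k. {x. ?f k < U x})"
    proof (intro monoI subsetI)
      fix k l :: nat and x
      assume kl: "k \<le> l" and x: "x \<in> {x. ?f k < U x}"
      have "?f l \<le> ?f k" using kl by (intro ennreal_leI) (simp add: frac_le)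
      with x show "x \<in> {x. ?f l < U x}" by (auto intro: order.strict_trans1)
    qed
    then have sup: "(SUP k. d (?f k)) = d t"
      unfolding d_def Un by (intro SUP_emeasure_incseq) (use meas in auto)
    then obtain k where k: "ball_vol x < d (?f k)"
      using * unfolding sup[symmetric] less_SUP_iff by blast
    have "t < ?f k" using r by (simp add: ennreal_less_iff del: of_nat_Suc ennreal_plus)
    also have "?f k \<le> v x" unfolding v_def using k by (intro Sup_upper) simp
    finally show "t < v x" .
  qed
  have level: "{x. t < v x} = {x. ball_vol x < d t}" for t
    using key by simp
  have vm: "{x. t < v x} \<in> sets lebesgue" and vopen: "open {x. t < v x}" for t
  proof -
    have "continuous_on UNIV (ball_vol :: real ^ 'n \<Rightarrow> ennreal)"
      unfolding ball_vol_def by (intro continuous_on_ennreal continuous_intros)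
    then show "open {x. t < v x}"
      unfolding level by (intro open_Collect_less continuous_on_const)
    then show "{x. t < v x} \<in> sets lebesgue"
      by (intro sets_completionI_sets) (simp add: borel_open)
  qed
  have vd: "emeasure lebesgue {x. t < v x} = d t" if "t > 0" for t
    unfolding level by (intro emeasure_ball_vol_less dfin that)
  have eq: "emeasure lebesgue {x. a < U x \<and> U x \<le> b} = emeasure lebesgue {x. a < v x \<and> v x \<le> b}"
    if "0 < a" "a < b" for a b
  proof -
    have "emeasure lebesgue {x. a < w x \<and> w x \<le> b} = d a - d b"
      if w: "\<And>t. {x. t < w x} \<in> sets lebesgue" "\<And>t. t > 0 \<Longrightarrow> emeasure lebesgue {x. t < w x} = d t"
      for w :: "real ^ 'n \<Rightarrow> ennreal"
    proof -
      have "{x. a < w x \<and> w x \<le> b} = {x. a < w x} - {x. b < w x}" by auto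
      moreover have "{x. b < w x} \<subseteq> {x. a < w x}" using \<open>a < b\<close> by auto
      moreover have "d b < \<infinity>" using \<open>0 < a\<close> \<open>a < b\<close> by (intro dfin) auto
      ultimately show ?thesis
        using w \<open>0 < a\<close> \<open>a < b\<close> by (simp add: emeasure_Diff)
    qed
    from this[of U] this[of v] show ?thesis using meas vm vd by (simp add: d_def)
  qed
  have vmono: "v y \<le> v x" if "norm x \<le> norm y" for x y
  proof -
    have "ball_vol x \<le> ball_vol y"
      unfolding ball_vol_def by (intro ennreal_leI mult_left_mono power_mono that) auto
    then have "{t. ball_vol y < d t} \<subseteq> {t. ball_vol x < d t}"
      using le_less_trans by blast
    then show ?thesis unfolding v_def by (rule Sup_subset_mono)
  qed
  have "is_schwarz_symmetrization u v"
    unfolding is_schwarz_symmetrization_def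
  proof (intro conjI allI impI)
    fix x y :: "real ^ 'n" assume "norm x = norm y"
    then show "v x = v y" by (intro antisym vmono) simp_all
  next
    fix a b assume "(INF x. ennreal (u x)) < a \<and> a < b"
    then have "0 < a" "a < b" using le_less_trans[OF zero_le] by blast+
    then show "emeasure lebesgue {x. a < ennreal (u x) \<and> ennreal (u x) \<le> b} =
        emeasure lebesgue {x. a < v x \<and> v x \<le> b}"
      using eq unfolding U_def by blast
  qed (fact vopen vmono)+
  then show ?thesis by blast
qed

lemma schwarz_level:
  fixes u :: "real ^ 'n \<Rightarrow> real"
  assumes u: "u \<in> vanishing_functions" and v: "is_schwarz_symmetrization u v" and t: "0 < t"
  shows "t < v x \<longleftrightarrow> ball_vol x < emeasure lebesgue {x. t < ennreal (u x)}"
proof (cases "t = top")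
  case False
  define S where "S = {x. t < v x}"
  have openS: "open S"
    and down: "\<And>x y. norm x \<le> norm y \<Longrightarrow> v y \<le> v x"
    and equi: "\<And>a b. (INF x. ennreal (u x)) < a \<Longrightarrow> a < b \<Longrightarrow>
        emeasure lebesgue {x. a < ennreal (u x) \<and> ennreal (u x) \<le> b} =
        emeasure lebesgue {x. a < v x \<and> v x \<le> b}"
    using v unfolding is_schwarz_symmetrization_def S_def by blast+
  obtain r where r: "t = ennreal r" "r > 0"
    using False t by (cases t) auto
  have level: "{x. t < ennreal (u x)} = {x. r < u x}"
    using r by (auto simp: ennreal_less_iff)
  have fin: "emeasure lebesgue {x. t < ennreal (u x)} < \<infinity>"
    unfolding level using u r(2) by (simp add: vanishing_functions_def)
  have inf: "(INF x. ennreal (u x)) < t"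
  proof (rule ccontr)
    assume "\<not> (INF x. ennreal (u x)) < t"
    then have "t \<le> (INF x. ennreal (u x))" by simp
    then have "t \<le> ennreal (u x)" for x
      unfolding le_INF_iff by blast
    then have "r \<le> u x" for x
      using r(2) unfolding r(1) ennreal_le_iff2 by (meson not_le order_trans)
    then have "{x. r / 2 < u x} = UNIV"
      using r(2) by (intro set_eqI) (smt (verit) UNIV_I field_sum_of_halves mem_Collect_eq)
    moreover have "emeasure lebesgue {x. r / 2 < u x} < \<infinity>"
      using u half_gt_zero[OF r(2)] unfolding vanishing_functions_def by blast
    ultimately show False by simp
  qed
  have S: "emeasure lebesgue S = emeasure lebesgue {x. t < ennreal (u x)}"
    using equi[OF inf, of top] False by (simp add: S_def top.not_eq_extremum)
  have Sm: "S \<in> sets lebesgue"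
    using openS by (intro sets_completionI_sets) (simp add: borel_open)
  show ?thesis
  proof
    assume x: "t < v x"
    have sub: "cball 0 (norm x) \<subseteq> S"
      using x down by (auto simp: S_def intro!: less_le_trans[OF x])
    have le: "ball_vol x \<le> emeasure lebesgue S"
      using emeasure_mono[OF sub Sm] by (simp add: emeasure_ball_vol)
    show "ball_vol x < emeasure lebesgue {x. t < ennreal (u x)}"
    proof (rule ccontr)
      assume "\<not> ?thesis"
      then have eq: "emeasure lebesgue S = ball_vol x" using le S by auto
      have "emeasure lebesgue (S - cball 0 (norm x)) = emeasure lebesgue S - ball_vol x"
        using sub Sm by (subst emeasure_Diff) (auto simp: emeasure_ball_vol ball_vol_def emeasure_cball)
      also have "\<dots> = 0" using eq fin S by simp
      finally have "negligible (S - cball 0 (norm x))"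
        using Sm by (simp add: negligible_iff_null_sets null_sets_def sets.Diff sets_completionI_sets)
      moreover have "open (S - cball 0 (norm x))" using openS by (intro open_Diff) auto
      ultimately have "S - cball 0 (norm x) = {}"
        by (metis open_not_negligible)
      then have "S = cball 0 (norm x)" using sub by blast
      then have "closed S" "S \<noteq> {}" by auto
      then have "S = UNIV" using openS clopen[of S] by simp
      then show False using fin S by simp
    qed
  next
    assume less: "ball_vol x < emeasure lebesgue {x. t < ennreal (u x)}"
    show "t < v x"
    proof (rule ccontr)
      assume nx: "\<not> t < v x"
      have "S \<subseteq> ball 0 (norm x)"
      proof
        fix y assume "y \<in> S"
        then have "\<not> norm x \<le> norm y" using down[of x y] nx by (auto simp: S_def)
        then show "y \<in> ball 0 (norm x)" by simp
      qed
      then have "emeasure lebesgue S \<le> ball_vol x"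
        using emeasure_mono[of S "ball 0 (norm x)" lebesgue] by (simp add: emeasure_ball_vol)
      with less S show False by simp
    qed
  qed
qed auto

lemma schwarz_ex1:
  assumes u: "u \<in> vanishing_functions"
  shows "\<exists>!v. is_schwarz_symmetrization u v"
proof -
  have "v x \<le> w x" if vw: "is_schwarz_symmetrization u v" "is_schwarz_symmetrization u w" for v w x
  proof (rule ccontr)
    assume "\<not> v x \<le> w x"
    then obtain t where "w x < t" "t < v x" using dense[of "w x" "v x"] by (auto simp: not_le)
    moreover from this have "0 < t" using le_less_trans[OF zero_le] by blast
    ultimately show False
      using schwarz_level[OF u vw(1), of t x] schwarz_level[OF u vw(2), of t x] by simp
  qed
  then have "v = w" if "is_schwarz_symmetrization u v" "is_schwarz_symmetrization u w" for v w
    using that by (intro ext antisym) blast+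
  then show ?thesis
    using schwarz_existence[OF u] by blast
qed

lemma schwarz_symmetrization:
  assumes "u \<in> vanishing_functions"
  shows "is_schwarz_symmetrization u (schwarz_symmetrization u)"
  unfolding schwarz_symmetrization_def using theI'[OF schwarz_ex1[OF assms]] .

end

theory Submission
  imports Defs
begin

text \<open>Test the inequality on two-step functions: \<open>u\<^sub>i\<close> has height \<open>y\<^sub>i\<close> on a ball \<open>B\<close> and is raised by
  \<open>h\<close> on a small concentric ball, \<open>u\<^sub>j\<close> has height \<open>y\<^sub>j\<close> on \<open>B\<close> and is raised by \<open>k\<close> on a disjoint
  ball of the same size inside \<open>B\<close>, and the other components have height \<open>y\<^sub>l\<close> on \<open>B\<close>. Symmetrization moves the second
  bump onto the first one, and \<open>F\<close> vanishes at \<open>0\<close>, hence outside \<open>B\<close>. After cancelling the common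
  volume, the integral inequality is the supermodularity inequality.\<close>

definition bump :: "real \<Rightarrow> real \<Rightarrow> real ^ 'n \<Rightarrow> real ^ 'n \<Rightarrow> real" where
  "bump c h p x = (if x \<in> ball p 1 then c + h else if x \<in> ball 0 3 then c else 0)"

lemma unit_ball_subset_ball_3:
  fixes p :: "real ^ 'n"
  assumes "norm p \<le> 2"
  shows "ball p 1 \<subseteq> ball 0 3"
  using assms by (simp add: ball_subset_ball_iff)

text \<open>The right-hand side does not contain \<open>p\<close>, so any two admissible centres
  give equimeasurable bumps. An arbitrary predicate \<open>P\<close> covers the layers between two
  levels in one statement.\<close>

lemma emeasure_bump_level:
  fixes p :: "real ^ 'n"
  assumes p: "norm p \<le> 2"
  shows "emeasure lebesgue {x. P (bump c h p x)} =
    (if P (c + h) then emeasure lebesgue (ball (0 :: real ^ 'n) 1) else 0) +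
    (if P c then emeasure lebesgue (ball (0 :: real ^ 'n) 3) - emeasure lebesgue (ball (0 :: real ^ 'n) 1) else 0) +
    (if P 0 then emeasure lebesgue (- ball (0 :: real ^ 'n) 3) else 0)"
proof -
  note sub = unit_ball_subset_ball_3[OF p]
  have p1: "emeasure lebesgue (ball p 1) = emeasure lebesgue (ball (0 :: real ^ 'n) 1)"
    by (simp add: emeasure_ball)
  have diff: "emeasure lebesgue (ball 0 3 - ball p 1) =
      emeasure lebesgue (ball (0 :: real ^ 'n) 3) - emeasure lebesgue (ball (0 :: real ^ 'n) 1)"
    using sub p1 by (subst emeasure_Diff) (auto simp: emeasure_ball)
  define A where "A = (if P (c + h) then ball p 1 else {})"
  define B where "B = (if P c then ball 0 3 - ball p 1 else {})"
  define C where "C = (if P 0 then - ball (0 :: real ^ 'n) 3 else {})"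
  have sets: "A \<in> sets lebesgue" "B \<in> sets lebesgue" "C \<in> sets lebesgue"
    by (auto simp: A_def B_def C_def Compl_in_sets_lebesgue)
  have "{x. P (bump c h p x)} = (A \<union> B) \<union> C"
    using sub by (auto simp: bump_def A_def B_def C_def split: if_splits)
  moreover have "A \<inter> B = {}" "(A \<union> B) \<inter> C = {}"
    using sub by (auto simp: A_def B_def C_def split: if_splits)
  ultimately have "emeasure lebesgue {x. P (bump c h p x)} =
      emeasure lebesgue A + emeasure lebesgue B + emeasure lebesgue C"
    using sets by (simp add: plus_emeasure[symmetric] sets.Un)
  then show ?thesis
    using p1 diff by (simp add: A_def B_def C_def)
qed

lemma bump_vanishing:
  fixes p :: "real ^ 'n"
  assumes "norm p \<le> 2" "0 \<le> c" "0 \<le> h"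
  shows "bump c h p \<in> vanishing_functions"
proof -
  have [measurable]: "ball q r \<in> sets borel" for q :: "real ^ 'n" and r
    by (simp add: borel_open)
  have "bump c h p \<in> borel_measurable lborel"
    unfolding bump_def[abs_def] by measurable
  then have m: "bump c h p \<in> borel_measurable lebesgue"
    by (rule measurable_completion)
  have "emeasure lebesgue {x. t < bump c h p x} < \<infinity>" if "0 < t" for t
  proof -
    have "{x. t < bump c h p x} \<subseteq> ball 0 3"
      using that unit_ball_subset_ball_3[OF assms(1)] by (auto simp: bump_def split: if_splits)
    then have "emeasure lebesgue {x. t < bump c h p x} \<le> emeasure lebesgue (ball (0 :: real ^ 'n) 3)"
      by (intro emeasure_mono) auto
    also have "\<dots> < \<infinity>"
      by (simp add: emeasure_ball)
    finally show ?thesis .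
  qed
  with m show ?thesis
    using assms by (auto simp: vanishing_functions_def bump_def)
qed

text \<open>The bump centred at the origin is radially nonincreasing, is lower semicontinuous
  because the balls are open, and is equimeasurable with the given one; uniqueness does the
  rest.\<close>

lemma schwarz_symmetrization_bump:
  fixes p :: "real ^ 'n"
  assumes p: "norm p \<le> 2" and c: "0 \<le> c" and h: "0 \<le> h"
  shows "schwarz_symmetrization (bump c h p) = (\<lambda>x. ennreal (bump c h 0 x))"
proof -
  have "is_schwarz_symmetrization (bump c h p) (\<lambda>x. ennreal (bump c h 0 x))"
    unfolding is_schwarz_symmetrization_def
  proof (intro conjI allI impI)
    fix t
    \<comment> \<open>Nested heights make each superlevel set a union of centred balls, never an
      annulus.\<close>
    have "ennreal c \<le> ennreal (c + h)"
      using h by (intro ennreal_leI) simp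
    then have "{x :: real ^ 'n. t < ennreal (bump c h 0 x)} =
        (if t < ennreal (c + h) then ball 0 1 else {}) \<union> (if t < ennreal c then ball 0 3 else {})"
      by (auto simp: bump_def simp del: ennreal_plus split: if_splits)
    then show "open {x :: real ^ 'n. t < ennreal (bump c h 0 x)}"
      by (simp add: open_Un)
  next
    fix a b
    show "emeasure lebesgue {x. a < ennreal (bump c h p x) \<and> ennreal (bump c h p x) \<le> b} =
        emeasure lebesgue {x :: real ^ 'n. a < ennreal (bump c h 0 x) \<and> ennreal (bump c h 0 x) \<le> b}"
      using emeasure_bump_level[OF p, of "\<lambda>s. a < ennreal s \<and> ennreal s \<le> b" c h]
        emeasure_bump_level[of "0 :: real ^ 'n" "\<lambda>s. a < ennreal s \<and> ennreal s \<le> b" c h]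
      by simp
  qed (use c h in \<open>auto simp: bump_def simp del: ennreal_plus intro!: ennreal_leI\<close>)
  then show ?thesis
    unfolding schwarz_symmetrization_def
    by (rule the1_equality[OF schwarz_ex1[OF bump_vanishing[OF assms]]])
qed

text \<open>Positive and negative parts both have finite integral, so the extended difference is a
  real one. This reduces the hypothesis on \<open>F\<close> to Bochner integrals.\<close>

lemma ext_integral_eq_integral:
  assumes "integrable lebesgue g"
  shows "has_ext_integral g" and "ext_integral g = ereal (integral\<^sup>L lebesgue g)"
proof -
  obtain r q where "0 \<le> r" "0 \<le> q" "(\<integral>\<^sup>+ x. ennreal (g x) \<partial>lebesgue) = ennreal r"
      "(\<integral>\<^sup>+ x. ennreal (- g x) \<partial>lebesgue) = ennreal q" "integral\<^sup>L lebesgue g = r - q"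
    using assms by (elim integrableE)
  then show "has_ext_integral g" "ext_integral g = ereal (integral\<^sup>L lebesgue g)"
    using assms by (auto simp: has_ext_integral_def ext_integral_def enn2ereal_ennreal)
qed

theorem proposition3p1:
  fixes F :: "real ^ 'm \<Rightarrow> real"
  assumes "F \<in> borel_measurable (restrict_space borel nonneg_orthant)"
    and "vanishes_on_hyperplanes F"
    and "\<And>u :: 'm \<Rightarrow> real ^ 'n \<Rightarrow> real.
           (\<forall>i. u i \<in> vanishing_functions) \<Longrightarrow>
           has_ext_integral (\<lambda>x. F (\<chi> i. u i x)) \<Longrightarrow>
           has_ext_integral (\<lambda>x. F (\<chi> i. enn2real (schwarz_symmetrization (u i) x))) \<Longrightarrow>
           ext_integral (\<lambda>x. F (\<chi> i. u i x))
             \<le> ext_integral (\<lambda>x. F (\<chi> i. enn2real (schwarz_symmetrization (u i) x)))"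
  shows "supermodular F"
  unfolding supermodular_def
proof (intro ballI allI impI)
  fix y :: "real ^ 'm" and i j :: 'm and h k :: real
  assume y: "y \<in> nonneg_orthant" and h: "0 < h" and k: "0 < k" and ij: "i \<noteq> j"
  have y0: "0 \<le> y $ l" for l
    using y by (simp add: nonneg_orthant_def)
  have F0: "F 0 = 0"
    using assms(2) by (auto simp: vanishes_on_hyperplanes_def nonneg_orthant_def)
  \<comment> \<open>At distance 2 the open unit balls about \<open>0\<close> and \<open>p\<close>
    are disjoint, and both still fit into the ball of radius 3.\<close>
  obtain p :: "real ^ 'n" where p: "norm p = 2"
    using vector_choose_size[of 2] by auto
  define A where "A = ball (0 :: real ^ 'n) 1"
  define B where "B = ball (0 :: real ^ 'n) 3"
  define C where "C = ball p 1"
  have AB: "A \<subseteq> B" and CB: "C \<subseteq> B"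
    using p unit_ball_subset_ball_3[of p] by (auto simp: A_def B_def C_def)
  have AC: "A \<inter> C = {}"
    unfolding A_def C_def by (rule disjoint_ballI) (simp add: p dist_norm)
  \<comment> \<open>Raise 0 turns the remaining components into plain steps on \<open>B\<close>, so
    every component is a bump. Only component \<open>j\<close> is off centre.\<close>
  define H where "H l = (if l = i then h else if l = j then k else 0)" for l
  define u where "u l = bump (y $ l) (H l) (if l = j then p else 0)" for l
  have H0: "0 \<le> H l" for l
    using h k by (simp add: H_def)
  have sym: "enn2real (schwarz_symmetrization (u l) x) = bump (y $ l) (H l) 0 x" for l x
  proof -
    have "0 \<le> bump (y $ l) (H l) 0 x"
      using y0[of l] H0[of l] by (simp add: bump_def)
    then show ?thesis
      unfolding u_def using p y0 H0 by (simp add: schwarz_symmetrization_bump)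
  qed
  define a b d f where "a = F (y + h *\<^sub>R axis i 1)" and "b = F (y + k *\<^sub>R axis j 1)"
    and "d = F (y + h *\<^sub>R axis i 1 + k *\<^sub>R axis j 1)" and "f = F y"
  have bump0: "bump c g 0 x = (if x \<in> A then c + g else if x \<in> B then c else 0)"
    and bump_p: "bump c g p x = (if x \<in> C then c + g else if x \<in> B then c else 0)" for c g x
    by (simp_all only: bump_def A_def B_def C_def)
  have vals: "(\<chi> l. u l x) = (if x \<in> A then y + h *\<^sub>R axis i 1 else if x \<in> C then y + k *\<^sub>R axis j 1
      else if x \<in> B then y else 0)" for x
    using ij AB CB AC
    by (auto simp: vec_eq_iff u_def bump0 bump_p H_def axis_def)
  have vals': "(\<chi> l. bump (y $ l) (H l) 0 x) =
      (if x \<in> A then y + h *\<^sub>R axis i 1 + k *\<^sub>R axis j 1 else if x \<in> B then y else 0)" for x :: "real ^ 'n"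
    using ij by (auto simp: vec_eq_iff bump0 H_def axis_def)
  \<comment> \<open>\<open>F0\<close> removes the complement of \<open>B\<close>, which has infinite
    measure; this makes the integrals finite.\<close>
  have L: "(\<lambda>x. F (\<chi> l. u l x)) = (\<lambda>x. a * indicator A x + b * indicator C x
      + f * (indicator B x - indicator A x - indicator C x))"
    using AB CB AC by (auto simp: fun_eq_iff vals a_def b_def f_def F0 indicator_def)
  have R: "(\<lambda>x. F (\<chi> l. enn2real (schwarz_symmetrization (u l) x))) =
      (\<lambda>x. d * indicator A x + f * (indicator B x - indicator A x))"
    using AB by (auto simp: fun_eq_iff sym vals' d_def f_def F0 indicator_def)
  have int[simp]: "integrable lebesgue (indicator A :: _ \<Rightarrow> real)"
      "integrable lebesgue (indicator B :: _ \<Rightarrow> real)" "integrable lebesgue (indicator C :: _ \<Rightarrow> real)"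
    by (auto simp: A_def B_def C_def emeasure_ball)
  have mC: "measure lebesgue C = measure lebesgue A"
    by (simp add: A_def C_def content_ball)
  have mA: "0 < measure lebesgue A"
    by (simp add: A_def content_ball)
  have iL: "integrable lebesgue (\<lambda>x. F (\<chi> l. u l x))"
    and iR: "integrable lebesgue (\<lambda>x. F (\<chi> l. enn2real (schwarz_symmetrization (u l) x)))"
    unfolding L R by simp_all
  have "\<forall>l. u l \<in> vanishing_functions"
    using p y0 H0 by (simp add: u_def bump_vanishing)
  then have "integral\<^sup>L lebesgue (\<lambda>x. F (\<chi> l. u l x)) \<le>
      integral\<^sup>L lebesgue (\<lambda>x. F (\<chi> l. enn2real (schwarz_symmetrization (u l) x)))"
    using assms(3)[of u] by (simp add: ext_integral_eq_integral iL iR)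
  \<comment> \<open>The terms \<open>f * measure lebesgue B\<close> cancel. Since \<open>C\<close>
    and \<open>A\<close> have equal measure, \<open>-2 * f\<close> remains on the left against
    \<open>-f\<close> on the right.\<close>
  then have "(a + b - f) * measure lebesgue A \<le> d * measure lebesgue A"
    unfolding L R by (simp add: mC algebra_simps)
  then have "a + b - f \<le> d"
    using mA by simp
  then show "F (y + h *\<^sub>R axis i 1 + k *\<^sub>R axis j 1) + F y
      \<ge> F (y + h *\<^sub>R axis i 1) + F (y + k *\<^sub>R axis j 1)"
    by (simp add: a_def b_def d_def f_def)
qed

end
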